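(* The infinite matrix $T=[T(n,k)]_{n,k\ge 0}$, where $T(n,k)=\frac{n!}{k!\,k!\,(n-2k)!}=\binom{n}{2k}\binom{2k}{k}$ for $0\le k\le \lfloor n/2\rfloor$ and $T(n,k)=0$ for $k>\lfloor n/2\rfloor$, is totally positive.
   Context: A (finite or infinite) real matrix is called totally positive if its minors of all (finite) orders are nonnegative. *)

theory Defs
  imports Complex_Main "Jordan_Normal_Form.Determinant"
begin

text \<open>An infinite real matrix with rows and columns indexed by the natural numbers is a function
  of type \<^typ>\<open>nat \<Rightarrow> nat \<Rightarrow> real\<close>. A minor of order \<open>r\<close> is obtained by choosing \<open>r\<close> rows
  \<open>\<rho> 0 < \<dots> < \<rho> (r - 1)\<close> and \<open>r\<close> columns \<open>\<gamma> 0 < \<dots> < \<gamma> (r - 1)\<close>; only the values of \<open>\<rho>\<close> and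
  \<open>\<gamma>\<close> below \<open>r\<close> matter.\<close>

definition minor ::
  "(nat \<Rightarrow> nat \<Rightarrow> real) \<Rightarrow> nat \<Rightarrow> (nat \<Rightarrow> nat) \<Rightarrow> (nat \<Rightarrow> nat) \<Rightarrow> real" where
  "minor A r \<rho> \<gamma> = det (mat r r (\<lambda>(i, j). A (\<rho> i) (\<gamma> j)))"

text \<open>Total positivity in the sense of nonnegative (not strictly positive) minors. The case
  \<open>r = 0\<close> holds trivially, as the empty determinant is 1.\<close>

definition totally_positive :: "(nat \<Rightarrow> nat \<Rightarrow> real) \<Rightarrow> bool" where
  "totally_positive A \<longleftrightarrow>
     (\<forall>r \<rho> \<gamma>. strict_mono_on {..<r} \<rho> \<longrightarrow> strict_mono_on {..<r} \<gamma> \<longrightarrow> minor A r \<rho> \<gamma> \<ge> 0)"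

definition T :: "nat \<Rightarrow> nat \<Rightarrow> real" where
  "T n k = (if k \<le> n div 2 then fact n / (fact k * fact k * fact (n - 2 * k)) else 0)"

lemma T_eq_binomial:
  assumes "k \<le> n div 2"
  shows "T n k = real (n choose (2 * k)) * real ((2 * k) choose k)"
proof -
  from assms have "2 * k \<le> n" by simp
  then show ?thesis
    using assms by (simp add: T_def binomial_fact)
qed

end

theory Submission
  imports Defs
begin

text \<open>Since \<open>T(n,k) = C(2k,k) C(n,2k)\<close>, every minor of \<open>T\<close> is a nonnegative multiple of a
  minor of Pascal's triangle, taken in the columns \<open>2k\<close>. For Pascal's triangle, expand every column
  of a minor by \<open>C(n,k) = C(n-1,k) + C(n-1,k-1)\<close>. Each of the resulting determinants either
  has a zero column, or two equal columns, or is a minor with all row indices lowered by 1; when the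
  first row index is 0, the first row is zero or a unit vector, and the order drops.\<close>

lemma minor_transpose: "minor A r \<rho> \<gamma> = minor (\<lambda>i j. A j i) r \<gamma> \<rho>"
proof -
  have "transpose_mat (mat r r (\<lambda>(i, j). A (\<rho> i) (\<gamma> j))) = mat r r (\<lambda>(i, j). A (\<rho> j) (\<gamma> i))"
    by (intro eq_matI) auto
  then show ?thesis
    unfolding minor_def by (metis det_transpose mat_carrier)
qed

lemma minor_scale_rows:
  "minor (\<lambda>i j. c i * A i j) r \<rho> \<gamma> = (\<Prod>i<r. c (\<rho> i)) * minor A r \<rho> \<gamma>"
proof -
  let ?a = "\<lambda>i. vec r (\<lambda>j. A (\<rho> i) (\<gamma> j))"
  have "mat r r (\<lambda>(i, j). c (\<rho> i) * A (\<rho> i) (\<gamma> j)) = mat\<^sub>r r r (\<lambda>i. c (\<rho> i) \<cdot>\<^sub>v ?a i)"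
    by (intro eq_matI) auto
  moreover have "mat r r (\<lambda>(i, j). A (\<rho> i) (\<gamma> j)) = mat\<^sub>r r r ?a"
    by (intro eq_matI) auto
  moreover have "det (mat\<^sub>r r r (\<lambda>i. c (\<rho> i) \<cdot>\<^sub>v ?a i)) = (\<Prod>i\<in>{0..<r}. c (\<rho> i)) * det (mat\<^sub>r r r ?a)"
    by (rule det_rows_mul) auto
  ultimately show ?thesis
    by (simp add: minor_def atLeast0LessThan)
qed

lemma minor_scale_columns:
  "minor (\<lambda>i j. c j * A i j) r \<rho> \<gamma> = (\<Prod>j<r. c (\<gamma> j)) * minor A r \<rho> \<gamma>"
  unfolding minor_transpose[of "\<lambda>i j. c j * A i j"] minor_transpose[of A]
  by (rule minor_scale_rows)

text \<open>Scaling columns multiplies a minor by a product of nonnegative factors, and a strictly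
  increasing \<open>h\<close> turns the chosen columns into an admissible choice of columns of
  \<open>A\<close>. This carries total positivity over from Pascal's triangle to
  \<open>T\<close>.\<close>

lemma totally_positive_scale_select_columns:
  assumes "totally_positive A" and "\<And>k. c k \<ge> 0" and "strict_mono h"
  shows "totally_positive (\<lambda>n k. c k * A n (h k))"
  unfolding totally_positive_def
proof (intro allI impI)
  fix r :: nat and \<rho> \<gamma> :: "nat \<Rightarrow> nat"
  assume \<rho>: "strict_mono_on {..<r} \<rho>" and \<gamma>: "strict_mono_on {..<r} \<gamma>"
  have "strict_mono_on {..<r} (\<lambda>j. h (\<gamma> j))"
    using \<gamma> assms(3) by (auto simp: strict_mono_on_def strict_mono_def)
  with \<rho> assms(1) have "0 \<le> minor A r \<rho> (\<lambda>j. h (\<gamma> j))"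
    by (auto simp: totally_positive_def)
  then have "0 \<le> minor (\<lambda>n k. A n (h k)) r \<rho> \<gamma>"
    by (simp add: minor_def)
  then show "0 \<le> minor (\<lambda>n k. c k * A n (h k)) r \<rho> \<gamma>"
    unfolding minor_scale_columns using assms(2) by (intro mult_nonneg_nonneg prod_nonneg) auto
qed

text \<open>By multilinearity the determinant is a sum over all choices \<open>f\<close> of one
  summand per row.\<close>

lemma det_row_sums_nonneg:
  fixes a :: "nat \<Rightarrow> nat \<Rightarrow> nat \<Rightarrow> 'a :: {comm_ring_1, ordered_comm_monoid_add}"
  assumes "finite S"
    and nonneg: "\<And>f. (\<And>i. i < n \<Longrightarrow> f i \<in> S) \<Longrightarrow> 0 \<le> det (mat n n (\<lambda>(i, j). a i (f i) j))"
  shows "0 \<le> det (mat n n (\<lambda>(i, j). \<Sum>s\<in>S. a i s j))"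
proof -
  let ?v = "\<lambda>i s. vec n (a i s)"
  have "mat n n (\<lambda>(i, j). \<Sum>s\<in>S. a i s j) = mat\<^sub>r n n (\<lambda>i. finsum_vec TYPE('a) n (?v i) S)"
    by (intro eq_matI) (auto simp: index_finsum_vec[OF assms(1)])
  \<comment> \<open>Fixing \<open>f i = i\<close> outside the index range makes each choice of
    summands occur exactly once.\<close>
  then have "det (mat n n (\<lambda>(i, j). \<Sum>s\<in>S. a i s j)) =
      (\<Sum>f | (\<forall>i\<in>{0..<n}. f i \<in> S) \<and> (\<forall>i. i \<notin> {0..<n} \<longrightarrow> f i = i). det (mat\<^sub>r n n (\<lambda>i. ?v i (f i))))"
    by (simp only:) (rule det_linear_rows_sum[OF assms(1)], auto)
  also have "\<dots> \<ge> 0"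
  proof (rule sum_nonneg)
    fix f assume "f \<in> {f. (\<forall>i\<in>{0..<n}. f i \<in> S) \<and> (\<forall>i. i \<notin> {0..<n} \<longrightarrow> f i = i)}"
    then have "0 \<le> det (mat n n (\<lambda>(i, j). a i (f i) j))"
      by (intro nonneg) auto
    also have "mat n n (\<lambda>(i, j). a i (f i) j) = mat\<^sub>r n n (\<lambda>i. ?v i (f i))"
      by (intro eq_matI) auto
    finally show "0 \<le> det (mat\<^sub>r n n (\<lambda>i. ?v i (f i)))" .
  qed
  finally show ?thesis .
qed

lemma minor_equal_columns:
  assumes "i < r" "j < r" "i \<noteq> j" "\<gamma> i = \<gamma> j"
  shows "minor A r \<rho> \<gamma> = 0"
  unfolding minor_transpose[of A] unfolding minor_def
  by (rule det_identical_rows[of _ r i j]) (use assms in \<open>auto intro!: eq_vecI\<close>)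

lemma det_zero_row:
  assumes "A \<in> carrier_mat n n" "i < n" "\<And>j. j < n \<Longrightarrow> A $$ (i, j) = 0"
  shows "det A = 0"
  using laplace_expansion_row[OF assms(1,2)] assms(3) by simp

text \<open>Laplace expansion along the first row leaves a single term, whose sign is
  positive.\<close>

lemma minor_first_row_unit:
  assumes "A (\<rho> 0) (\<gamma> 0) = 1" and "\<And>j. 0 < j \<Longrightarrow> j \<le> r \<Longrightarrow> A (\<rho> 0) (\<gamma> j) = 0"
  shows "minor A (Suc r) \<rho> \<gamma> = minor A r (\<lambda>i. \<rho> (Suc i)) (\<lambda>j. \<gamma> (Suc j))"
proof -
  let ?M = "mat (Suc r) (Suc r) (\<lambda>(i, j). A (\<rho> i) (\<gamma> j))"
  have "minor A (Suc r) \<rho> \<gamma> = (\<Sum>j<Suc r. ?M $$ (0, j) * cofactor ?M 0 j)"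
    unfolding minor_def by (rule laplace_expansion_row) auto
  also have "\<dots> = cofactor ?M 0 0"
    unfolding sum.lessThan_Suc_shift using assms by simp
  also have "\<dots> = det (mat_delete ?M 0 0)"
    by (simp add: cofactor_def)
  also have "mat_delete ?M 0 0 = mat r r (\<lambda>(i, j). A (\<rho> (Suc i)) (\<gamma> (Suc j)))"
    by (intro eq_matI) (auto simp: mat_delete_def)
  finally show ?thesis
    by (simp add: minor_def)
qed

text \<open>Pascal's rule needs positive row indices. Since it shifts some of the columns,
  \<open>nonneg\<close> has to cover every increasing \<open>\<gamma>'\<close>, not just
  \<open>\<gamma>\<close>.\<close>

lemma minor_binomial_pascal:
  assumes pos: "\<And>i. i < r \<Longrightarrow> 0 < \<rho> i" and \<gamma>: "strict_mono_on {..<r} \<gamma>"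
    and nonneg: "\<And>\<gamma>'. strict_mono_on {..<r} \<gamma>' \<Longrightarrow>
      0 \<le> minor (\<lambda>n k. real (n choose k)) r (\<lambda>i. \<rho> i - 1) \<gamma>'"
  shows "0 \<le> minor (\<lambda>n k. real (n choose k)) r \<rho> \<gamma>"
proof -
  let ?B = "\<lambda>n k. real (n choose k)"
  \<comment> \<open>Here \<open>i\<close> runs over the columns of the minor and \<open>j\<close>
    over its rows: the matrix is transposed so that \<open>det_row_sums_nonneg\<close> applies. The
    guard is there because truncated subtraction would send \<open>\<gamma> i - 1\<close> to 0 at
    \<open>\<gamma> i = 0\<close>, where the second term of Pascal's rule must vanish.\<close>
  define a where "a i s j = (if s \<le> \<gamma> i then ?B (\<rho> j - 1) (\<gamma> i - s) else 0)" for i s j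
  have pascal: "?B (\<rho> j) (\<gamma> i) = (\<Sum>s\<in>{0, 1}. a i s j)" if "j < r" for i j
    using pos[OF that] by (cases "\<rho> j"; cases "\<gamma> i") (auto simp: a_def)
  have "0 \<le> det (mat r r (\<lambda>(i, j). \<Sum>s\<in>{0, 1}. a i s j))"
  proof (rule det_row_sums_nonneg)
    fix f :: "nat \<Rightarrow> nat"
    assume f: "\<And>i. i < r \<Longrightarrow> f i \<in> {0, 1}"
    show "0 \<le> det (mat r r (\<lambda>(i, j). a i (f i) j))"
    proof (cases "\<forall>i<r. f i \<le> \<gamma> i")
      \<comment> \<open>Some \<open>i\<close> has \<open>f i = 1\<close> and
        \<open>\<gamma> i = 0\<close>, so the guard makes row \<open>i\<close> zero.\<close>
      case False
      then obtain i where "i < r" "\<not> f i \<le> \<gamma> i"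
        by blast
      then show ?thesis
        by (subst det_zero_row[of _ r i]) (auto simp: a_def)
    next
      case True
      let ?\<gamma>' = "\<lambda>i. \<gamma> i - f i"
      have "mat r r (\<lambda>(i, j). a i (f i) j) = mat r r (\<lambda>(i, j). ?B (\<rho> j - 1) (?\<gamma>' i))"
        using True by (intro eq_matI) (auto simp: a_def)
      then have eq: "det (mat r r (\<lambda>(i, j). a i (f i) j)) = minor ?B r (\<lambda>i. \<rho> i - 1) ?\<gamma>'"
        by (simp add: minor_transpose[of ?B] minor_def)
      show ?thesis
      proof (cases "strict_mono_on {..<r} ?\<gamma>'")
        case True
        then show ?thesis
          unfolding eq by (rule nonneg)
      next
        case False
        then obtain i j where ij: "i < r" "j < r" "i < j" "?\<gamma>' j \<le> ?\<gamma>' i"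
          unfolding strict_mono_on_def by (auto simp: not_less)
        \<comment> \<open>Shifts by at most 1 leave a strictly increasing sequence weakly
          increasing, so strictness can only fail through two equal columns.\<close>
        have "\<gamma> i < \<gamma> j"
          using \<gamma> ij by (auto simp: strict_mono_on_def)
        then have "?\<gamma>' i = ?\<gamma>' j"
          using f[of i] f[of j] ij by auto
        then show ?thesis
          unfolding eq using ij minor_equal_columns[of i r j ?\<gamma>'] by simp
      qed
    qed
  qed simp
  also have "mat r r (\<lambda>(i, j). \<Sum>s\<in>{0, 1}. a i s j) = mat r r (\<lambda>(i, j). ?B (\<rho> j) (\<gamma> i))"
    by (intro eq_matI) (auto simp: pascal simp del: sum.insert)
  finally show ?thesis
    by (simp add: minor_transpose[of ?B] minor_def)
qed

lemma totally_positive_binomial: "totally_positive (\<lambda>n k. real (n choose k))"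
proof -
  let ?B = "\<lambda>n k. real (n choose k)"
  have "0 \<le> minor ?B r \<rho> \<gamma>"
    if "strict_mono_on {..<r} \<rho>" "strict_mono_on {..<r} \<gamma>" for r and \<rho> \<gamma> :: "nat \<Rightarrow> nat"
    using that
  proof (induction r arbitrary: \<rho> \<gamma>)
    case 0
    then show ?case
      by (simp add: minor_def)
  next
    case (Suc r)
    have *: "strict_mono_on {..<r} (\<lambda>i. g (Suc i))"
      if "strict_mono_on {..<Suc r} g" for g :: "nat \<Rightarrow> nat"
      using that by (auto simp: strict_mono_on_def)
    \<comment> \<open>Inside the induction on the order, a second induction lowers the first row
      index while the order \<open>Suc r\<close> stays fixed; its base case falls back on the
      smaller order.\<close>
    from Suc.prems show ?case
    proof (induction "\<rho> 0" arbitrary: \<rho> \<gamma>)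
      case 0
      \<comment> \<open>Row 0 of Pascal's triangle is the unit vector at column 0, so in the first
        row of the minor only the entry at \<open>\<gamma> 0\<close> can be nonzero.\<close>
      have \<gamma>_pos: "0 < \<gamma> j" if "0 < j" "j \<le> r" for j
        using 0(3) that unfolding strict_mono_on_def
        by (metis lessThan_iff less_Suc_eq_le less_nat_zero_code neq0_conv zero_less_Suc)
      show ?case
      proof (cases "\<gamma> 0 = 0")
        case True
        have "minor ?B (Suc r) \<rho> \<gamma> = minor ?B r (\<lambda>i. \<rho> (Suc i)) (\<lambda>j. \<gamma> (Suc j))"
          by (rule minor_first_row_unit) (use True 0(1) \<gamma>_pos in \<open>auto simp flip: 0(1)\<close>)
        then show ?thesis
          using Suc.IH[OF *[OF 0(2)] *[OF 0(3)]] by simp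
      next
        case False
        then have "0 < \<gamma> j" if "j < Suc r" for j
          using \<gamma>_pos[of j] that by (cases "j = 0") auto
        then have "minor ?B (Suc r) \<rho> \<gamma> = 0"
          unfolding minor_def
          by (intro det_zero_row[of _ "Suc r" 0]) (auto simp flip: 0(1))
        then show ?thesis
          by simp
      qed
    next
      case (Suc m)
      have pos: "0 < \<rho> i" if "i < Suc r" for i
        using Suc(2,3) that unfolding strict_mono_on_def
        by (metis lessThan_iff neq0_conv not_less_zero zero_less_Suc)
      \<comment> \<open>With all row indices positive the truncated subtraction is exact, so the
        lowered rows still increase; they start at \<open>m\<close>, where the inner hypothesis
        applies.\<close>
      have \<rho>': "strict_mono_on {..<Suc r} (\<lambda>i. \<rho> i - 1)"
        using Suc(3) pos unfolding strict_mono_on_def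
        by (auto intro!: diff_less_mono simp: Suc_le_eq)
      show ?case
      proof (rule minor_binomial_pascal)
        show "0 \<le> minor ?B (Suc r) (\<lambda>i. \<rho> i - 1) \<gamma>'" if "strict_mono_on {..<Suc r} \<gamma>'" for \<gamma>'
          using Suc(2) by (intro Suc(1) \<rho>' that) simp
      qed (use pos Suc(4) in auto)
    qed
  qed
  then show ?thesis
    by (simp add: totally_positive_def)
qed

theorem theorem2p2:
  shows "totally_positive T"
proof -
  have "T = (\<lambda>n k. real (2 * k choose k) * real (n choose (2 * k)))"
  proof (intro ext)
    fix n k
    show "T n k = real (2 * k choose k) * real (n choose (2 * k))"
    proof (cases "k \<le> n div 2")
      case True
      then show ?thesis
        by (simp add: T_eq_binomial)
    next
      \<comment> \<open>Beyond the support of \<open>T\<close>, the lower index \<open>2 * k\<close>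
        exceeds \<open>n\<close>, so the binomial coefficient matches the default value 0.\<close>
      case False
      then have "n < 2 * k"
        by simp
      with False show ?thesis
        by (simp add: T_def binomial_eq_0)
    qed
  qed
  then show ?thesis
    using totally_positive_scale_select_columns[OF totally_positive_binomial,
        of "\<lambda>k. real (2 * k choose k)" "\<lambda>k. 2 * k"]
    by (simp add: strict_mono_def)
qed

end
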